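(* Let $\mathbf L=(L,\vee,\wedge,0,1)$ be a bounded lattice, $a,b\in L$ with $a\leq b$, $x\in[a,b]$, and let $y$ be a complement of $x$ (i.e. $x\vee y=1$, $x\wedge y=0$). Assume that $(a,y,b)$ is a modular triple and put $e:=(a\vee y)\wedge b=a\vee(y\wedge b)$. Then the following are equivalent: (i) $e\in R(a,b,x)$; (ii) $(a,y\wedge b,x)$ and $(x,a\vee y,b)$ are modular triples.
   Context: For a lattice and elements $a\leq b$, $x\in[a,b]$, an element $z\in[a,b]$ is a relative complement of $x$ in $[a,b]$ if $x\vee z=b$ and $x\wedge z=a$; $R(a,b,x)$ denotes the set of all such relative complements. A triple $(p,q,r)$ of elements of a lattice is called modular if $p\leq r$ and $(p\vee q)\wedge r=p\vee(q\wedge r)$. *)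

theory Defs
  imports Main
begin

unbundle lattice_syntax

definition is_complement :: "'a::bounded_lattice \<Rightarrow> 'a \<Rightarrow> bool" where
  "is_complement x y \<longleftrightarrow> x \<squnion> y = \<top> \<and> x \<sqinter> y = \<bottom>"

text \<open>Meant for \<open>a \<le> b\<close> and \<open>x \<in> {a..b}\<close>.\<close>
definition relative_complements :: "'a::lattice \<Rightarrow> 'a \<Rightarrow> 'a \<Rightarrow> 'a set" where
  "relative_complements a b x = {z \<in> {a..b}. x \<squnion> z = b \<and> x \<sqinter> z = a}"

definition modular_triple :: "'a::lattice \<Rightarrow> 'a \<Rightarrow> 'a \<Rightarrow> bool" where
  "modular_triple p q r \<longleftrightarrow> p \<le> r \<and> (p \<squnion> q) \<sqinter> r = p \<squnion> (q \<sqinter> r)"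

end

theory Submission
  imports Defs
begin

text \<open>Since \<open>x \<squnion> y = \<top>\<close> and \<open>x \<sqinter> y = \<bottom>\<close>, one side of each modularity equation in (ii) collapses, to
  \<open>a\<close> and to \<open>b\<close> respectively; what remains is \<open>x \<sqinter> e = a\<close> and \<open>x \<squnion> e = b\<close>, where the first uses
  the form \<open>e = a \<squnion> (y \<sqinter> b)\<close> and the second the form \<open>e = (a \<squnion> y) \<sqinter> b\<close>.\<close>

theorem theorem3:
  fixes a b x y e :: "'a::bounded_lattice"
  assumes "a \<le> b"
    and "x \<in> {a..b}"
    and "is_complement x y"
    and "modular_triple a y b"
    and "e = (a \<squnion> y) \<sqinter> b"
  shows "e \<in> relative_complements a b x \<longleftrightarrow>
    modular_triple a (y \<sqinter> b) x \<and> modular_triple x (a \<squnion> y) b"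
proof -
  have ax: "a \<le> x" and xb: "x \<le> b"
    using assms(2) by auto
  have join: "x \<squnion> y = \<top>" and meet: "x \<sqinter> y = \<bottom>"
    using assms(3) by (auto simp: is_complement_def)
  have e': "e = a \<squnion> (y \<sqinter> b)"
    using assms(4,5) by (simp add: modular_triple_def)
  \<comment> \<open>The join form of \<open>e\<close> shows the lower bound, the meet form the upper
    one.\<close>
  have "a \<le> e" "e \<le> b"
    using e' assms(1,5) by simp_all
  then have "e \<in> relative_complements a b x \<longleftrightarrow> x \<squnion> e = b \<and> x \<sqinter> e = a"
    by (simp add: relative_complements_def)
  \<comment> \<open>Because \<open>x \<le> b\<close>, the factor \<open>b\<close> is absorbed and
    \<open>x \<sqinter> y\<close> remains. This makes the right side of the first modular equation
    \<open>a\<close>; its left side is \<open>e \<sqinter> x\<close>.\<close>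
  moreover have "y \<sqinter> b \<sqinter> x = \<bottom>"
    using meet xb by (metis inf.absorb2 inf.assoc inf.commute)
  then have "modular_triple a (y \<sqinter> b) x \<longleftrightarrow> x \<sqinter> e = a"
    using ax e' by (simp add: modular_triple_def inf.commute)
  \<comment> \<open>Dually, the left side of the second equation becomes
    \<open>\<top> \<sqinter> b = b\<close>; its right side is \<open>x \<squnion> e\<close>.\<close>
  moreover have "x \<squnion> (a \<squnion> y) = \<top>"
    using join by (simp add: sup.left_commute)
  then have "modular_triple x (a \<squnion> y) b \<longleftrightarrow> x \<squnion> e = b"
    using xb assms(5) by (auto simp: modular_triple_def)
  ultimately show ?thesis
    by blast
qed

end
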